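(* Let $M$ be a prime number, let $K$ be an integer with $1\le K<M$, and let $0<p<1$. Let the number $L$ of contending users be binomially distributed, with $q(L)=\binom{M}{L}p^L(1-p)^{M-L}$ the probability of $L$ users for $0\le L\le M$; put $q_0=q(0)=(1-p)^M$ and $\hat q(L)=q(L)/(1-q_0)$ for $1\le L\le M$. Let $S(L)$ be the expected number of slots used by the $K$-threshold binary splitting protocol (defined in the context) to resolve $L$ contending users, and let $$\overline{R}_{\mathrm{res}} = \sum_{L=1}^M \frac{L}{S(L)}\,\hat q(L)$$ be the expected number of users resolved per slot, averaged over $L$ conditioned on $L>0$. Put $$\beta^* = 1 + \frac{1}{(K+1)(2^K-1)} + \frac{2}{K+1} + \frac{1}{K}.$$ Then $$\overline{R}_{\mathrm{res}} \ge \frac{\beta^* I_{1-p}(M-K,K+1) + I_{p}(K+1,M-K) - q_0\beta^*}{(1-q_0)\beta^*},$$ where $I_x(a,b)$ is the regularized incomplete beta function.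
   Context: The regularized incomplete beta function is $I_x(a,b)=B(x;a,b)/B(1;a,b)$ with $B(x;a,b)=\int_0^x t^{a-1}(1-t)^{b-1}\,dt$, for $a,b>0$ and $0\le x\le 1$. There are $M$ users in total, each contending independently with probability $p$, so the number $L$ of contending users is binomial with parameters $M$ and $p$. The $K$-threshold binary splitting protocol (contention resolution with parameter $K\ge1$) acts on a finite set of contending users, of size $L$, as follows. In the first slot all $L$ users transmit simultaneously. - If $L=0$, the slot is idle and the procedure ends; an empty group uses exactly one slot. - If $1\le L\le K$, the receiver learns exactly which users are active, together with the (finite-field) sum of their messages. In the next $L-1$ slots, $L-1$ of the users are scheduled to transmit individually, after which all $L$ messages are known and the procedure ends. In total $L$ slots are used. - If $L>K$, this first slot is spent without resolving any user. Each of the $L$ users then independently flips a fair coin to join group 1 or group 2. The same procedure is applied recursively, first to group 1 and, once it ends, to group 2 (with fresh independent coin flips at each split). The number of slots used is one plus the numbers of slots used by the two recursive executions. $S(L)$ is the expected total number of slots used when starting with $L$ users, the expectation being over all the coin flips. *)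

theory Defs
  imports "HOL-Probability.Probability" "HOL-Computational_Algebra.Primes"
begin

definition incomplete_beta :: "real \<Rightarrow> real \<Rightarrow> real \<Rightarrow> real" where
  "incomplete_beta x a b = integral {0..x} (\<lambda>t. t powr (a - 1) * (1 - t) powr (b - 1))"

definition reg_incomplete_beta :: "real \<Rightarrow> real \<Rightarrow> real \<Rightarrow> real" where
  "reg_incomplete_beta x a b = incomplete_beta x a b / incomplete_beta 1 a b"

text \<open>
  Distribution of the number of slots used by the \<open>K\<close>-threshold binary splitting protocol on
  the finite set \<open>U\<close> of contending users. The mass that this subprobability distribution
  lacks (its value \<open>None\<close>) is the probability that the recursion never ends.
\<close>

partial_function (spmf) splitting_slots :: "nat \<Rightarrow> nat set \<Rightarrow> nat spmf" where
  "splitting_slots K U =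
    (if U = {} then return_spmf 1
     else if card U \<le> K then return_spmf (card U)
     else do {
       coin \<leftarrow> spmf_of_pmf (Pi_pmf U False (\<lambda>_. bernoulli_pmf (1 / 2)));
       m \<leftarrow> splitting_slots K {u \<in> U. coin u};
       n \<leftarrow> splitting_slots K {u \<in> U. \<not> coin u};
       return_spmf (1 + m + n)
     })"

text \<open>A run that never ends counts as infinitely many slots.\<close>

definition expected_slots_ennreal :: "nat \<Rightarrow> nat \<Rightarrow> ennreal" where
  "expected_slots_ennreal K L =
    (\<integral>\<^sup>+ r. (case r of None \<Rightarrow> \<infinity> | Some n \<Rightarrow> of_nat n)
       \<partial>measure_pmf (splitting_slots K {..<L}))"

text \<open>
  An infinite expectation would be sent to \<open>0\<close> here, which still gives
  \<open>L / S(L) = 0\<close> below, because division by \<open>0\<close> yields \<open>0\<close>.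
\<close>

definition expected_slots :: "nat \<Rightarrow> nat \<Rightarrow> real" where
  "expected_slots K L = enn2real (expected_slots_ennreal K L)"

definition contending_prob :: "nat \<Rightarrow> real \<Rightarrow> nat \<Rightarrow> real" where
  "contending_prob M p L = pmf (binomial_pmf M p) L"

definition contending_prob_pos :: "nat \<Rightarrow> real \<Rightarrow> nat \<Rightarrow> real" where
  "contending_prob_pos M p L = contending_prob M p L / (1 - contending_prob M p 0)"

definition mean_resolution_rate :: "nat \<Rightarrow> nat \<Rightarrow> real \<Rightarrow> real" where
  "mean_resolution_rate K M p =
    (\<Sum>L = 1..M. real L / expected_slots K L * contending_prob_pos M p L)"

definition beta_star :: "nat \<Rightarrow> real" where
  "beta_star K = 1 + 1 / ((real K + 1) * (2 ^ K - 1)) + 2 / (real K + 1) + 1 / real K"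

end

theory Submission
  imports Defs
begin

text \<open>
  The two incomplete beta values are \<open>P(L \<le> K)\<close> and \<open>P(L > K)\<close> for binomial \<open>L\<close>, so the bound
  amounts to \<open>L / S(L) = 1\<close> for \<open>1 \<le> L \<le> K\<close> and \<open>L / S(L) \<ge> 1 / \<beta>\<^sup>*\<close> for \<open>L > K\<close>.
  The latter holds because the function equal to \<open>1\<close> at \<open>0\<close>, to \<open>L\<close> for \<open>1 \<le> L \<le> K\<close>
  and to \<open>\<beta>\<^sup>* L - 1\<close> above \<open>K\<close> is a supersolution of the recursion for \<open>S\<close>. Fixpoint induction
  bounds the expectation over terminating runs by it, without knowing beforehand that
  this expectation is finite, and the protocol terminates almost surely.
\<close>

section \<open>Binomial tails as incomplete beta integrals\<close>

text \<open>With \<open>T i = n * (n - 1 choose i) * x ^ i * (1 - x) ^ (n - 1 - i)\<close>, the two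
  absorption identities turn the derivative of the summand with index \<open>i + 1\<close> into
  \<open>T i - T (i + 1)\<close>. The sum telescopes and only \<open>- T k\<close> remains.\<close>

lemma binomial_cdf_has_real_derivative:
  fixes x :: real
  assumes "k < n"
  shows "((\<lambda>x. \<Sum>i\<le>k. real (n choose i) * x ^ i * (1 - x) ^ (n - i)) has_real_derivative
    - (real n * real (n - 1 choose k) * x ^ k * (1 - x) ^ (n - 1 - k))) (at x)"
  using assms
proof (induction k)
  case 0
  then show ?case by (auto intro!: derivative_eq_intros)
next
  case (Suc k)
  have 1: "real (n choose Suc k) * real (Suc k) = real n * real (n - 1 choose k)"
    using binomial_absorption[of k n] by (metis mult.commute of_nat_mult)
  have 2: "real (n choose Suc k) * real (n - Suc k) = real n * real (n - 1 choose Suc k)"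
    using binomial_absorb_comp[of n "Suc k"] by (metis mult.commute of_nat_mult)
  have "((\<lambda>x. real (n choose Suc k) * x ^ Suc k * (1 - x) ^ (n - Suc k)) has_real_derivative
      (real (n choose Suc k) * real (Suc k)) * x ^ k * (1 - x) ^ (n - Suc k)
      - (real (n choose Suc k) * real (n - Suc k)) * x ^ Suc k * (1 - x) ^ (n - Suc k - 1)) (at x)"
    by (auto intro!: derivative_eq_intros simp: algebra_simps simp del: power_Suc)
  then have "((\<lambda>x. real (n choose Suc k) * x ^ Suc k * (1 - x) ^ (n - Suc k)) has_real_derivative
      real n * real (n - 1 choose k) * x ^ k * (1 - x) ^ (n - 1 - k)
      - real n * real (n - 1 choose Suc k) * x ^ Suc k * (1 - x) ^ (n - 1 - Suc k)) (at x)"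
    unfolding 1 2 by (simp add: diff_commute)
  from DERIV_add[OF Suc.IH this] Suc.prems show ?case
    by (simp add: algebra_simps)
qed

text \<open>
  At \<open>t = 0\<close> and \<open>t = 1\<close> the \<open>powr\<close> integrand may differ from the polynomial one,
  as \<open>0 powr 0 = 0\<close> but \<open>0 ^ 0 = 1\<close>; the proof discards these two points.
\<close>

lemma incomplete_beta_binomial_cdf:
  assumes "k < n" "0 \<le> x" "x \<le> 1"
  shows "real n * real (n - 1 choose k) * incomplete_beta x (real k + 1) (real n - real k) =
    1 - (\<Sum>i\<le>k. real (n choose i) * x ^ i * (1 - x) ^ (n - i))"
proof -
  define c where "c = real n * real (n - 1 choose k)"
  define F where "F x = (\<Sum>i\<le>k. real (n choose i) * x ^ i * (1 - x) ^ (n - i))" for x :: real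
  define g where "g t = t ^ k * (1 - t) ^ (n - 1 - k)" for t :: real
  have c: "c > 0"
    using assms(1) unfolding c_def by (auto intro!: mult_pos_pos simp: zero_less_binomial_iff)
  have "(F has_real_derivative - (c * g t)) (at t)" for t
    using binomial_cdf_has_real_derivative[OF assms(1), of t]
    unfolding F_def c_def g_def by (simp add: mult.assoc)
  then have "((\<lambda>t. - (F t / c)) has_real_derivative g t) (at t)" for t
    using c by (auto intro!: derivative_eq_intros)
  then have "(g has_integral (- (F x / c) - - (F 0 / c))) {0..x}"
    using assms(2) by (intro fundamental_theorem_of_calculus)
      (auto simp flip: has_real_derivative_iff_has_vector_derivative
        intro: has_field_derivative_at_within)
  moreover have "F 0 = 1"
    unfolding F_def by (subst sum.remove[of _ 0]) (auto intro!: sum.neutral)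
  ultimately have "(g has_integral (1 - F x) / c) {0..x}"
    by (simp add: diff_divide_distrib)
  then have "((\<lambda>t. t powr (real k + 1 - 1) * (1 - t) powr (real n - real k - 1))
      has_integral (1 - F x) / c) {0..x}"
  proof (rule has_integral_spike[of "{0, 1}", rotated 2])
    fix t assume t: "t \<in> {0..x} - {0, 1}"
    have "real n - real k - 1 = real (n - 1 - k)" using assms(1) by simp
    have "0 < t" "0 < 1 - t" using t assms(3) by auto
    then show "t powr (real k + 1 - 1) * (1 - t) powr (real n - real k - 1) = g t"
      unfolding g_def \<open>real n - real k - 1 = _\<close> by (simp only: powr_realpow add_diff_cancel_right')
  qed simp
  then show ?thesis
    using c unfolding incomplete_beta_def c_def[symmetric] F_def[symmetric]
    by (simp add: integral_unique)
qed

lemma reg_incomplete_beta_binomial_cdf: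
  assumes "k < n" "0 \<le> x" "x \<le> 1"
  shows "reg_incomplete_beta x (real k + 1) (real n - real k) =
    1 - (\<Sum>i\<le>k. real (n choose i) * x ^ i * (1 - x) ^ (n - i))"
proof -
  define c where "c = real n * real (n - 1 choose k)"
  have c: "c > 0"
    using assms(1) unfolding c_def by (auto intro!: mult_pos_pos simp: zero_less_binomial_iff)
  \<comment> \<open>At \<open>x = 1\<close> every term has a factor \<open>0 ^ (n - i)\<close> with
    \<open>i < n\<close>, so the complete beta integral is \<open>1 / c\<close>.\<close>
  have "(\<Sum>i\<le>k. real (n choose i) * 1 ^ i * (1 - 1) ^ (n - i)) = 0"
    using assms(1) by (intro sum.neutral) auto
  with incomplete_beta_binomial_cdf[OF assms(1), of 1]
  have "c * incomplete_beta 1 (real k + 1) (real n - real k) = 1"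
    by (simp add: c_def)
  then have "incomplete_beta 1 (real k + 1) (real n - real k) = 1 / c"
    using c by (simp add: field_simps)
  with incomplete_beta_binomial_cdf[OF assms] c show ?thesis
    unfolding reg_incomplete_beta_def c_def[symmetric] by (simp add: mult.commute)
qed

lemma binomial_mass_split:
  fixes p :: real
  assumes "K < M"
  shows "(\<Sum>i\<le>K. real (M choose i) * p ^ i * (1 - p) ^ (M - i)) +
    (\<Sum>i = Suc K..M. real (M choose i) * p ^ i * (1 - p) ^ (M - i)) = 1"
proof -
  have "{..M} = {..K} \<union> {Suc K..M}" using assms by auto
  then have "(\<Sum>i\<le>K. real (M choose i) * p ^ i * (1 - p) ^ (M - i)) +
    (\<Sum>i = Suc K..M. real (M choose i) * p ^ i * (1 - p) ^ (M - i)) =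
    (\<Sum>i\<le>M. real (M choose i) * p ^ i * (1 - p) ^ (M - i))"
    by (simp add: sum.union_disjoint)
  also have "\<dots> = 1" using binomial_ring[of p "1 - p" M] by simp
  finally show ?thesis .
qed

lemma reg_incomplete_beta_eq_binomial_tail:
  assumes "K < M" "0 \<le> p" "p \<le> 1"
  shows "reg_incomplete_beta p (real K + 1) (real M - real K) =
    (\<Sum>i = Suc K..M. contending_prob M p i)"
  using reg_incomplete_beta_binomial_cdf[OF assms] binomial_mass_split[OF assms(1), of p] assms
  by (simp add: contending_prob_def)

text \<open>Counting the users that stay silent, a binomial number with parameter
  \<open>1 - p\<close>, reduces this to the previous identity: at most \<open>K\<close> users
  contend iff more than \<open>M - K - 1\<close> are silent.\<close>

lemma reg_incomplete_beta_eq_binomial_cdf: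
  assumes "K < M" "0 \<le> p" "p \<le> 1"
  shows "reg_incomplete_beta (1 - p) (real M - real K) (real K + 1) =
    (\<Sum>i\<le>K. contending_prob M p i)"
proof -
  define k where "k = M - K - 1"
  have k: "k < M" "real M - real K = real k + 1" "real K + 1 = real M - real k"
    using assms(1) by (auto simp: k_def)
  have "(\<Sum>i\<le>k. real (M choose i) * (1 - p) ^ i * (1 - (1 - p)) ^ (M - i)) =
      (\<Sum>i = Suc K..M. real (M choose i) * p ^ i * (1 - p) ^ (M - i))"
    using assms(1)
    by (intro sum.reindex_bij_witness[of _ "\<lambda>i. M - i" "\<lambda>i. M - i"])
      (auto simp: k_def binomial_symmetric[symmetric])
  with reg_incomplete_beta_binomial_cdf[OF k(1), of "1 - p"] binomial_mass_split[OF assms(1), of p]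
  show ?thesis
    unfolding k(2,3) using assms by (simp add: contending_prob_def)
qed

section \<open>A supersolution of the slot recursion\<close>

text \<open>
  Above \<open>K\<close> the line \<open>\<beta> L - 1\<close> solves the slot recursion exactly, whatever \<open>\<beta>\<close> is;
  \<open>\<beta>\<^sup>*\<close> only has to make the deviations \<open>2\<close> (at \<open>0\<close>) and \<open>i + 1 - \<beta> i\<close> (at \<open>1 \<le> i \<le> K\<close>)
  from that line average to something nonpositive.
\<close>

definition slots_majorant :: "nat \<Rightarrow> nat \<Rightarrow> real" where
  "slots_majorant K L =
    (if L = 0 then 1 else if L \<le> K then real L else beta_star K * real L - 1)"

lemma beta_star_ge_1:
  assumes "1 \<le> K"
  shows "beta_star K \<ge> 1"
  unfolding beta_star_def by simp

lemma slots_majorant_nonneg: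
  assumes "1 \<le> K"
  shows "slots_majorant K L \<ge> 0"
  using mult_mono[OF beta_star_ge_1[OF assms], of 1 "real L"] beta_star_ge_1[OF assms]
  by (auto simp: slots_majorant_def)

text \<open>
  With \<open>A\<close> the sum of the \<open>L - 1\<close> choose \<open>i\<close> over \<open>i < K\<close>, the claim reads
  \<open>1 + 2 A + (L - 1 choose K) \<le> (\<beta>\<^sup>* - 1) L A\<close>, and the three summands of
  \<open>\<beta>\<^sup>* - 1\<close> account for the three terms on the left.
\<close>

lemma beta_star_binomial_inequality:
  assumes "1 \<le> K" "K < L"
  shows "1 + (\<Sum>i\<le>K. real (L choose i) * (1 - (beta_star K - 1) * real i)) \<le> 0"
proof -
  obtain k where K: "K = Suc k" using assms(1) by (cases K) auto
  obtain l where L: "L = Suc l" using assms(2) by (cases L) auto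
  define A where "A = (\<Sum>i<K. real (l choose i))"
  define g where "g = beta_star K - 1"
  have Al: "A = (\<Sum>i\<le>k. real (l choose i))"
    unfolding A_def K lessThan_Suc_atMost ..
  \<comment> \<open>Pascal's rule reduces row \<open>L\<close> to row
    \<open>l = L - 1\<close>.\<close>
  have 1: "(\<Sum>i\<le>K. real (L choose i)) = 2 * A + real (l choose K)"
  proof -
    have "(\<Sum>i\<le>K. real (L choose i)) = 1 + (\<Sum>i\<le>k. real (l choose i) + real (l choose Suc i))"
      unfolding K L sum.atMost_Suc_shift by simp
    also have "\<dots> = A + (1 + (\<Sum>i\<le>k. real (l choose Suc i)))"
      by (simp add: sum.distrib Al)
    also have "1 + (\<Sum>i\<le>k. real (l choose Suc i)) = (\<Sum>i\<le>K. real (l choose i))"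
      unfolding K sum.atMost_Suc_shift by simp
    finally show ?thesis by (simp add: Al K)
  qed
  have 2: "(\<Sum>i\<le>K. real (L choose i) * real i) = real L * A"
  proof -
    have "real (L choose Suc i) * real (Suc i) = real L * real (l choose i)" for i
      using binomial_absorption[of i L] L by (metis diff_Suc_1 mult.commute of_nat_mult)
    then show ?thesis
      unfolding K sum.atMost_Suc_shift Al sum_distrib_left by simp
  qed
  \<comment> \<open>Since \<open>K \<le> l\<close>, row \<open>l\<close> dominates row
    \<open>K\<close>, whose entries below index \<open>K\<close> sum to
    \<open>2 ^ K - 1\<close>.\<close>
  have A1: "A \<ge> 2 ^ K - 1"
  proof -
    have "(2::real) ^ K = (\<Sum>i\<le>K. real (K choose i))"
      using choose_row_sum[of K] by (metis of_nat_numeral of_nat_power of_nat_sum)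
    also have "\<dots> = (\<Sum>i<K. real (K choose i)) + 1"
      by (simp add: lessThan_Suc_atMost[symmetric])
    also have "(\<Sum>i<K. real (K choose i)) \<le> A"
      unfolding A_def using assms(2) L by (intro sum_mono) (auto intro!: binomial_right_mono)
    finally show ?thesis by simp
  qed
  have A2: "A \<ge> real (l choose k)"
    unfolding Al by (rule member_le_sum) auto
  have p2: "(2::real) ^ K - 1 > 0" using assms(1) by simp
  have "A \<ge> 0" unfolding A_def by (simp add: sum_nonneg)
  have b1: "2 * A \<le> 2 / (real K + 1) * (real L * A)"
  proof -
    have "(real K + 1) * A \<le> real L * A" using assms(2) \<open>A \<ge> 0\<close> by (intro mult_right_mono) auto
    then show ?thesis by (simp add: field_simps)
  qed
  have b2: "real (l choose K) \<le> 1 / real K * (real L * A)"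
  proof -
    \<comment> \<open>Both sides of this identity equal \<open>l * (l - 1 choose k)\<close>;
      moreover \<open>l choose k\<close> is the last summand of \<open>A\<close>.\<close>
    have "real K * real (l choose K) = real (l - k) * real (l choose k)"
      using binomial_absorb_comp[of l k] binomial_absorption[of k l] K 
      by (metis of_nat_mult)
    also have "\<dots> \<le> real L * A"
      using A2 L by (intro mult_mono) auto
    finally show ?thesis using assms(1) by (simp add: field_simps)
  qed
  have b3: "1 \<le> 1 / ((real K + 1) * (2 ^ K - 1)) * (real L * A)"
  proof -
    have "(real K + 1) * (2 ^ K - 1) \<le> real L * A"
      using A1 assms(2) p2 by (intro mult_mono) auto
    moreover have "0 < (real K + 1) * (2 ^ K - 1)" using p2 by simp
    ultimately show ?thesis by (simp add: le_divide_eq)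
  qed
  have "g * (real L * A) = 1 / ((real K + 1) * (2 ^ K - 1)) * (real L * A)
      + 2 / (real K + 1) * (real L * A) + 1 / real K * (real L * A)"
    by (simp add: g_def beta_star_def distrib_right)
  then have "1 + (2 * A + real (l choose K)) - g * (real L * A) \<le> 0"
    using b1 b2 b3 by linarith
  moreover have "(\<Sum>i\<le>K. real (L choose i) * (1 - g * real i)) =
      (\<Sum>i\<le>K. real (L choose i)) - g * (\<Sum>i\<le>K. real (L choose i) * real i)"
    by (simp add: sum_distrib_left sum_subtractf algebra_simps)
  ultimately show ?thesis unfolding 1 2 g_def by simp
qed

text \<open>The group sizes \<open>i\<close> and \<open>L - i\<close> have the same distribution, so
  the mean is twice that of a single group. There the line contributes \<open>b * L - 2\<close> in
  total and the deviations \<open>e\<close> at most \<open>0\<close>; the slot of the collision then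
  gives \<open>b * L - 1\<close>.\<close>

lemma slots_majorant_supersolution:
  assumes "1 \<le> K" "K < L"
  shows "1 + (\<Sum>i\<le>L. real (L choose i) / 2 ^ L * (slots_majorant K i + slots_majorant K (L - i)))
    \<le> slots_majorant K L"
proof -
  define b where "b = beta_star K"
  define h where "h = slots_majorant K"
  define e where "e i = h i - (b * real i - 1)" for i
  have sum1: "(\<Sum>i\<le>L. real (L choose i)) = 2 ^ L"
    using choose_row_sum[of L] by (metis of_nat_numeral of_nat_power of_nat_sum)
  have sum2: "2 * (\<Sum>i\<le>L. real (L choose i) * real i) = real L * 2 ^ L"
  proof -
    obtain l where l: "L = Suc l" using assms(2) by (cases L) auto
    have "(\<Sum>i\<le>L. i * (L choose i)) = L * 2 ^ (L - 1)"
      by (rule choose_linear_sum)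
    then have "(\<Sum>i\<le>L. real (L choose i) * real i) = real L * 2 ^ (L - 1)"
      by (metis (no_types, lifting) mult.commute of_nat_mult of_nat_numeral of_nat_power of_nat_sum sum.cong)
    then show ?thesis by (simp add: l)
  qed
  have flip: "(\<Sum>i\<le>L. real (L choose i) * h (L - i)) = (\<Sum>i\<le>L. real (L choose i) * h i)"
    by (intro sum.reindex_bij_witness[of _ "\<lambda>i. L - i" "\<lambda>i. L - i"])
      (auto simp: binomial_symmetric[symmetric])
  have "(\<Sum>i\<le>L. real (L choose i) * e i) = (\<Sum>i\<le>K. real (L choose i) * e i)"
    using assms(2) by (intro sum.mono_neutral_right) (auto simp: e_def h_def slots_majorant_def b_def)
  also have "\<dots> = 1 + (\<Sum>i\<le>K. real (L choose i) * (1 - (b - 1) * real i))"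
  proof -
    \<comment> \<open>At \<open>0\<close> the expression \<open>1 - (b - 1) * real i\<close> gives
      only \<open>1\<close>; the missing unit is the leading \<open>1\<close> of the sum.\<close>
    have "e 0 = 2" by (simp add: e_def h_def slots_majorant_def)
    then show ?thesis
      by (subst (1 2) sum.remove[of _ 0])
        (auto simp: e_def h_def slots_majorant_def algebra_simps intro!: sum.cong)
  qed
  also have "\<dots> \<le> 0"
    unfolding b_def by (rule beta_star_binomial_inequality[OF assms])
  finally have e: "(\<Sum>i\<le>L. real (L choose i) * e i) \<le> 0" .
  have "(\<Sum>i\<le>L. real (L choose i) / 2 ^ L * (h i + h (L - i))) =
      ((\<Sum>i\<le>L. real (L choose i) * h i) + (\<Sum>i\<le>L. real (L choose i) * h (L - i))) / 2 ^ L"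
    by (simp add: sum_divide_distrib add_divide_distrib distrib_left sum.distrib)
  also have "\<dots> = 2 * (\<Sum>i\<le>L. real (L choose i) * h i) / 2 ^ L"
    unfolding flip by simp
  also have "2 * (\<Sum>i\<le>L. real (L choose i) * h i) = 
      b * (2 * (\<Sum>i\<le>L. real (L choose i) * real i)) - 2 * (\<Sum>i\<le>L. real (L choose i))
      + 2 * (\<Sum>i\<le>L. real (L choose i) * e i)"
    by (simp add: e_def sum_distrib_left sum.distrib[symmetric] sum_subtractf[symmetric]
        algebra_simps)
  also have "\<dots> / 2 ^ L \<le> b * real L - 2"
  proof -
    have "b * (real L * 2 ^ L) - 2 * 2 ^ L + 2 * (\<Sum>i\<le>L. real (L choose i) * e i)
       \<le> (b * real L - 2) * 2 ^ L"
      using e by (simp add: algebra_simps)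
    then show ?thesis unfolding sum1 sum2 by (simp add: pos_divide_le_eq)
  qed
  finally show ?thesis
    using assms by (simp add: h_def[symmetric]) (simp add: h_def slots_majorant_def b_def)
qed

section \<open>Expectations over terminating runs\<close>

lemma nn_integral_bind_spmf:
  "(\<integral>\<^sup>+ y. g y \<partial>measure_spmf (bind_spmf p f)) = (\<integral>\<^sup>+ x. \<integral>\<^sup>+ y. g y \<partial>measure_spmf (f x) \<partial>measure_spmf p)"
  unfolding measure_spmf_bind
  by (subst nn_integral_bind[where B = "count_space UNIV"]) auto

text \<open>Along a chain the point masses increase to those of the least upper bound, so by
  monotone convergence its integral is the supremum of the integrals.\<close>

lemma admissible_nn_integral_spmf_le:
  fixes g :: "nat \<Rightarrow> ennreal"
  shows "spmf.admissible (\<lambda>f. (\<integral>\<^sup>+ n. g n \<partial>measure_spmf (f x)) \<le> c)"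
proof (rule ccpo.admissibleI)
  fix Y :: "('a \<Rightarrow> nat spmf) set"
  assume chain: "Complete_Partial_Order.chain (fun_ord (ord_spmf (=))) Y"
    and Y: "Y \<noteq> {}" and le: "\<forall>f\<in>Y. (\<integral>\<^sup>+ n. g n \<partial>measure_spmf (f x)) \<le> c"
  define Z where "Z = {y. \<exists>f\<in>Y. y = f x}"
  have Z: "Z \<noteq> {}" "\<And>p. p \<in> Z \<Longrightarrow> (\<integral>\<^sup>+ n. g n \<partial>measure_spmf p) \<le> c"
    using Y le by (auto simp: Z_def)
  have chainZ: "Complete_Partial_Order.chain (ord_spmf (=)) Z"
    unfolding Z_def using chain by (rule chain_fun)
  have mono: "Complete_Partial_Order.chain (\<le>) ((\<lambda>p n. ennreal (spmf p n) * g n) ` Z)"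
    using chainZ by (rule chain_imageI)
      (auto simp: le_fun_def intro!: mult_right_mono ennreal_leI dest: ord_spmf_eq_leD)
  have "(\<integral>\<^sup>+ n. g n \<partial>measure_spmf (lub_spmf Z)) =
      (\<integral>\<^sup>+ n. (SUP p\<in>Z. ennreal (spmf p n) * g n) \<partial>count_space UNIV)"
    by (simp add: nn_integral_measure_spmf ennreal_spmf_lub_spmf[OF chainZ Z(1)]
        SUP_mult_right_ennreal Z(1))
  also have "\<dots> = (SUP p\<in>Z. \<integral>\<^sup>+ n. g n \<partial>measure_spmf p)"
    unfolding nn_integral_measure_spmf
    by (rule nn_integral_monotone_convergence_SUP_nat[OF mono Z(1)])
  also have "\<dots> \<le> c" using Z(2) by (rule SUP_least)
  finally show "(\<integral>\<^sup>+ n. g n \<partial>measure_spmf (fun_lub lub_spmf Y x)) \<le> c"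
    by (simp add: fun_lub_def Z_def)
qed

text \<open>Only an inequality, because \<open>p\<close> and \<open>q\<close> may have mass below
  \<open>1\<close>, and constants then integrate to less than themselves.\<close>

lemma nn_integral_bind_sum_spmf_le:
  "(\<integral>\<^sup>+ r. of_nat r \<partial>measure_spmf (bind_spmf p (\<lambda>m. bind_spmf q (\<lambda>n. return_spmf (1 + m + n))))) \<le>
    1 + ((\<integral>\<^sup>+ m. of_nat m \<partial>measure_spmf p) + (\<integral>\<^sup>+ n. of_nat n \<partial>measure_spmf q) :: ennreal)"
proof -
  have add: "(\<integral>\<^sup>+ x. c + f x \<partial>measure_spmf s) \<le> c + (\<integral>\<^sup>+ x. f x \<partial>measure_spmf s)"
    for c :: ennreal and f and s :: "nat spmf"
  proof -
    have "(\<integral>\<^sup>+ x. c \<partial>measure_spmf s) \<le> c"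
      by (rule measure_spmf.nn_integral_le_const) auto
    then show ?thesis
      by (subst nn_integral_add) (auto intro: add_right_mono)
  qed
  have "(\<integral>\<^sup>+ r. of_nat r \<partial>measure_spmf (bind_spmf p (\<lambda>m. bind_spmf q (\<lambda>n. return_spmf (1 + m + n))))) =
      (\<integral>\<^sup>+ m. \<integral>\<^sup>+ n. (1 + of_nat m) + of_nat n \<partial>measure_spmf q \<partial>measure_spmf p)"
    by (simp add: nn_integral_bind_spmf measure_spmf_return_spmf nn_integral_return add.assoc)
  also have "\<dots> \<le> (\<integral>\<^sup>+ m. (1 + of_nat m) + (\<integral>\<^sup>+ n. of_nat n \<partial>measure_spmf q) \<partial>measure_spmf p)"
    by (intro nn_integral_mono add)
  also have "\<dots> = (\<integral>\<^sup>+ m. (1 + (\<integral>\<^sup>+ n. of_nat n \<partial>measure_spmf q)) + of_nat m \<partial>measure_spmf p)"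
    by (simp only: ac_simps)
  also have "\<dots> \<le> 1 + (\<integral>\<^sup>+ n. of_nat n \<partial>measure_spmf q) + (\<integral>\<^sup>+ m. of_nat m \<partial>measure_spmf p)"
    by (rule add)
  also have "\<dots> = 1 + ((\<integral>\<^sup>+ m. of_nat m \<partial>measure_spmf p) + (\<integral>\<^sup>+ n. of_nat n \<partial>measure_spmf q))"
    by (simp only: ac_simps)
  finally show ?thesis .
qed

lemma card_split:
  assumes "finite U"
  shows "card {u \<in> U. \<not> coin u} = card U - card {u \<in> U. coin u}"
proof -
  have "{u \<in> U. \<not> coin u} = U - {u \<in> U. coin u}" by auto
  then show ?thesis using assms by (simp add: card_Diff_subset)
qed

text \<open>The size of group 1 is binomial with parameters \<open>card U\<close> and
  \<open>1 / 2\<close>.\<close>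

lemma nn_integral_coin_split:
  assumes "finite U" and nonneg: "\<And>i. f i \<ge> 0"
  shows "(\<integral>\<^sup>+ coin. ennreal (f (card {u \<in> U. coin u})) \<partial>measure_pmf (Pi_pmf U False (\<lambda>_. bernoulli_pmf (1 / 2)))) =
    ennreal (\<Sum>i\<le>card U. real (card U choose i) / 2 ^ card U * f i)"
proof -
  let ?n = "card U"
  have "(\<integral>\<^sup>+ coin. ennreal (f (card {u \<in> U. coin u})) \<partial>measure_pmf (Pi_pmf U False (\<lambda>_. bernoulli_pmf (1 / 2)))) =
      (\<integral>\<^sup>+ i. ennreal (f i) \<partial>measure_pmf (binomial_pmf ?n (1 / 2)))"
    by (subst binomial_pmf_altdef'[OF assms(1) refl, where dflt = False]) auto
  also have "\<dots> = (\<Sum>i\<le>?n. ennreal (f i) * ennreal (pmf (binomial_pmf ?n (1 / 2)) i))"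
    by (subst nn_integral_measure_pmf_support[of "{..?n}"])
      (auto simp: set_pmf_binomial_eq split: if_splits)
  also have "\<dots> = (\<Sum>i\<le>?n. ennreal (real (?n choose i) / 2 ^ ?n * f i))"
  proof (rule sum.cong[OF refl])
    fix i assume "i \<in> {..?n}"
    then have "pmf (binomial_pmf ?n (1 / 2)) i = real (?n choose i) / 2 ^ ?n"
      by (simp add: power_add[symmetric] power_divide)
    then show "ennreal (f i) * ennreal (pmf (binomial_pmf ?n (1 / 2)) i) =
        ennreal (real (?n choose i) / 2 ^ ?n * f i)"
      using nonneg by (simp add: mult.commute flip: ennreal_mult)
  qed
  also have "\<dots> = ennreal (\<Sum>i\<le>?n. real (?n choose i) / 2 ^ ?n * f i)"
    using nonneg by (intro sum_ennreal) auto
  finally show ?thesis .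
qed

section \<open>The majorant bounds the expectation\<close>

text \<open>Induction on \<open>card U\<close> would fail, as one group can again be all of
  \<open>U\<close>. Fixpoint induction starts from the program that never terminates, for which the
  integral over \<open>measure_spmf\<close> is \<open>0\<close>.\<close>

lemma splitting_slots_nn_integral_le:
  assumes K: "1 \<le> K" and "finite U"
  shows "(\<integral>\<^sup>+ n. of_nat n \<partial>measure_spmf (splitting_slots K U)) \<le> ennreal (slots_majorant K (card U))"
proof -
  let ?P = "\<lambda>s. \<forall>U. finite U \<longrightarrow>
    (\<integral>\<^sup>+ n. of_nat n \<partial>measure_spmf (s K U)) \<le> ennreal (slots_majorant K (card U))"
  have "?P splitting_slots"
  proof (rule splitting_slots.fixp_induct[where P = ?P])
    show "spmf.admissible (\<lambda>s. ?P (curry s))"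
      unfolding curry_def
      by (intro admissible_all admissible_imp admissible_nn_integral_spmf_le)
    show "?P (\<lambda>_ _. return_pmf None)" by simp
  next
    fix s :: "nat \<Rightarrow> nat set \<Rightarrow> nat spmf"
    assume IH: "?P s"
    show "?P (\<lambda>a b. if b = {} then return_spmf 1
       else if card b \<le> a then return_spmf (card b)
       else spmf_of_pmf (Pi_pmf b False (\<lambda>_. bernoulli_pmf (1 / 2))) \<bind>
         (\<lambda>coin. s a {u \<in> b. coin u} \<bind>
           (\<lambda>m. s a {u \<in> b. \<not> coin u} \<bind> (\<lambda>n. return_spmf (1 + m + n)))))"
    proof (intro allI impI)
      fix U :: "nat set" assume fin: "finite U"
      let ?h = "slots_majorant K"
      let ?coins = "Pi_pmf U False (\<lambda>_. bernoulli_pmf (1 / 2))"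
      let ?next = "\<lambda>coin. s K {u \<in> U. coin u} \<bind>
           (\<lambda>m. s K {u \<in> U. \<not> coin u} \<bind> (\<lambda>n. return_spmf (1 + m + n)))"
      consider "U = {}" | "U \<noteq> {}" "card U \<le> K" | "U \<noteq> {}" "K < card U" by linarith
      then show "(\<integral>\<^sup>+ n. of_nat n \<partial>measure_spmf
          (if U = {} then return_spmf 1
           else if card U \<le> K then return_spmf (card U)
           else spmf_of_pmf ?coins \<bind> ?next)) \<le> ennreal (?h (card U))"
      proof cases
        case 1
        then show ?thesis
          by (simp add: measure_spmf_return_spmf nn_integral_return slots_majorant_def)
      next
        case 2
        then show ?thesis using fin
          by (simp add: measure_spmf_return_spmf nn_integral_return slots_majorant_def
              ennreal_of_nat_eq_real_of_nat)
      next
        case 3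
        define f where "f i = 1 + (?h i + ?h (card U - i))" for i
        have h0: "?h i \<ge> 0" for i by (rule slots_majorant_nonneg[OF K])
        have "(\<integral>\<^sup>+ n. of_nat n \<partial>measure_spmf (spmf_of_pmf ?coins \<bind> ?next)) =
            (\<integral>\<^sup>+ coin. \<integral>\<^sup>+ n. of_nat n \<partial>measure_spmf (?next coin) \<partial>measure_pmf ?coins)"
          by (simp only: nn_integral_bind_spmf measure_spmf_spmf_of_pmf)
        also have "\<dots> \<le> (\<integral>\<^sup>+ coin. ennreal (f (card {u \<in> U. coin u})) \<partial>measure_pmf ?coins)"
        proof (rule nn_integral_mono)
          fix coin
          have "(\<integral>\<^sup>+ n. of_nat n \<partial>measure_spmf (?next coin)) \<le>
            1 + (ennreal (?h (card {u \<in> U. coin u})) + ennreal (?h (card {u \<in> U. \<not> coin u})))"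
            using IH fin
            by (intro order.trans[OF nn_integral_bind_sum_spmf_le] add_mono order.refl) auto
          also have "\<dots> = ennreal (f (card {u \<in> U. coin u}))"
            unfolding f_def card_split[OF fin] using h0 by (simp add: ennreal_plus)
          finally show "(\<integral>\<^sup>+ n. of_nat n \<partial>measure_spmf (?next coin)) \<le>
            ennreal (f (card {u \<in> U. coin u}))" .
        qed
        also have "\<dots> = ennreal (\<Sum>i\<le>card U. real (card U choose i) / 2 ^ card U * f i)"
          using fin h0 by (intro nn_integral_coin_split) (auto simp: f_def)
        also have "(\<Sum>i\<le>card U. real (card U choose i) / 2 ^ card U * f i) =
            1 + (\<Sum>i\<le>card U. real (card U choose i) / 2 ^ card U * (?h i + ?h (card U - i)))"
        proof -
          have "(\<Sum>i\<le>card U. real (card U choose i) / 2 ^ card U) = 1"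
            using choose_row_sum[of "card U"]
            by (simp flip: sum_divide_distrib of_nat_sum)
          then show ?thesis
            by (simp add: f_def distrib_left sum.distrib)
        qed
        also have "ennreal \<dots> \<le> ennreal (?h (card U))"
          by (rule ennreal_leI, rule slots_majorant_supersolution[OF K 3(2)])
        finally show ?thesis using 3 by simp
      qed
    qed
  qed
  then show ?thesis using assms(2) by blast
qed

section \<open>Almost sure termination\<close>

text \<open>
  The termination probability of \<open>U\<close> is the mean, over the coins, of the products for the two
  groups. By induction each product is at least the probability itself, and it is \<open>1\<close>
  when both groups are nonempty; so the mean can only agree if the probability is \<open>1\<close>.
\<close>

lemma weight_splitting_slots:
  assumes K: "1 \<le> K" and "finite U"
  shows "weight_spmf (splitting_slots K U) = 1"
  using assms(2)
proof (induction "card U" arbitrary: U rule: less_induct)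
  case less
  let ?S = "splitting_slots K"
  let ?coins = "Pi_pmf U False (\<lambda>_. bernoulli_pmf (1 / 2))"
  show ?case
  proof (cases "U = {} \<or> card U \<le> K")
    case True
    then have "splitting_slots K U = return_spmf (if U = {} then 1 else card U)"
      by (subst splitting_slots.simps) auto
    then show ?thesis by (simp only: weight_return_spmf)
  next
    case False
    then have big: "U \<noteq> {}" "K < card U" by auto
    define w where "w = weight_spmf (?S U)"
    define g where "g coin = weight_spmf (?S {u \<in> U. coin u}) * weight_spmf (?S {u \<in> U. \<not> coin u})" for coin
    have w: "0 \<le> w" "w \<le> 1" by (auto simp: w_def weight_spmf_le_1)
    have "?S {} = return_spmf 1" by (subst splitting_slots.simps) simp
    then have empty: "weight_spmf (?S {}) = 1" by (simp only: weight_return_spmf)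
    have split: "g coin = 1" if "{u \<in> U. coin u} \<noteq> U" "{u \<in> U. coin u} \<noteq> {}" for coin
    proof -
      have "card {u \<in> U. coin u} < card U" "card {u \<in> U. \<not> coin u} < card U"
        using that less.prems by (auto intro!: psubset_card_mono)
      then show ?thesis using less.hyps less.prems by (simp add: g_def)
    qed
    \<comment> \<open>If one group is all of \<open>U\<close>, the other is empty and terminates
      surely, so the product is \<open>w\<close> itself.\<close>
    have ge: "w \<le> g coin" for coin
    proof -
      consider "{u \<in> U. coin u} = U" "{u \<in> U. \<not> coin u} = {}"
        | "{u \<in> U. coin u} = {}" "{u \<in> U. \<not> coin u} = U"
        | "{u \<in> U. coin u} \<noteq> U" "{u \<in> U. coin u} \<noteq> {}"
        by blast
      then show ?thesis
      proof cases
        case 1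
        then show ?thesis unfolding g_def 1 by (simp add: empty w_def)
      next
        case 2
        then show ?thesis unfolding g_def 2 by (simp add: empty w_def)
      next
        case 3
        then show ?thesis using split w by simp
      qed
    qed
    have bounded: "0 \<le> g coin" "g coin \<le> 1" for coin
      by (auto simp: g_def weight_spmf_le_1 intro!: mult_le_one)
    have "?S U = spmf_of_pmf ?coins \<bind> (\<lambda>coin. ?S {u \<in> U. coin u} \<bind>
        (\<lambda>m. ?S {u \<in> U. \<not> coin u} \<bind> (\<lambda>n. return_spmf (1 + m + n))))"
      using big by (subst splitting_slots.simps) simp
    then have w_eq: "w = measure_pmf.expectation ?coins g"
      unfolding w_def g_def
      by (simp add: weight_bind_spmf o_def measure_spmf_spmf_of_pmf del: bind_spmf_of_pmf)
    obtain a where a: "a \<in> U" using big by auto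
    \<comment> \<open>The outcome that puts \<open>a\<close> alone in group 1 has positive
      probability and is a proper split, as \<open>card U > K \<ge> 1\<close>.\<close>
    define c where "c = (\<lambda>u. u = a)"
    have Ua: "{u \<in> U. c u} = {a}" using a by (auto simp: c_def)
    have "U \<noteq> {a}" using big K by auto
    then have gc: "g c = 1" using split[of c] Ua by auto
    have c: "c \<in> set_pmf ?coins"
      using less.prems a by (auto simp: set_Pi_pmf PiE_dflt_def c_def)
    have int: "integrable (measure_pmf ?coins) g"
      using bounded by (auto intro!: measure_pmf.integrable_const_bound[where B = 1])
    then have "measure_pmf.expectation ?coins (\<lambda>x. g x - w) = 0"
      using w_eq by (subst Bochner_Integration.integral_diff) auto
    moreover have "integrable (measure_pmf ?coins) (\<lambda>x. g x - w)"
      using int by (intro Bochner_Integration.integrable_diff) auto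
    \<comment> \<open>A nonnegative function with mean \<open>0\<close> vanishes at every outcome of
      positive probability, in particular at \<open>c\<close>.\<close>
    ultimately have "AE x in measure_pmf ?coins. g x - w = 0"
      using ge by (subst (asm) integral_nonneg_eq_0_iff_AE) auto
    then have "g c = w" using c by (auto simp: AE_measure_pmf_iff)
    with gc show ?thesis by (simp add: w_def)
  qed
qed

section \<open>Bounds on the expected number of slots\<close>

text \<open>By almost sure termination \<open>None\<close> has mass \<open>0\<close>, so its value
  \<open>\<infinity>\<close> does not contribute.\<close>

lemma expected_slots_ennreal_eq:
  assumes "1 \<le> K"
  shows "expected_slots_ennreal K L = (\<integral>\<^sup>+ n. of_nat n \<partial>measure_spmf (splitting_slots K {..<L}))"
proof -
  have "lossless_spmf (splitting_slots K {..<L})"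
    unfolding lossless_spmf_def using assms by (rule weight_splitting_slots) simp
  then obtain p where p: "splitting_slots K {..<L} = spmf_of_pmf p"
    by (auto simp: lossless_spmf_conv_spmf_of_pmf)
  show ?thesis
    unfolding expected_slots_ennreal_def p measure_spmf_spmf_of_pmf
    by (simp add: spmf_of_pmf_def)
qed

lemma expected_slots_small:
  assumes "1 \<le> L" "L \<le> K"
  shows "expected_slots K L = real L"
proof -
  have "splitting_slots K {..<L} = return_spmf L"
    using assms by (subst splitting_slots.simps) (auto simp: lessThan_empty_iff)
  then show ?thesis
    using expected_slots_ennreal_eq[of K L] assms
    by (simp add: expected_slots_def measure_spmf_return_spmf nn_integral_return)
qed

text \<open>Positivity is what allows inverting the upper bound: with
  \<open>expected_slots K L = 0\<close> the ratio \<open>L / S(L)\<close> would be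
  \<open>0\<close>.\<close>

lemma expected_slots_large:
  assumes "1 \<le> K" "K < L"
  shows "0 < expected_slots K L" "expected_slots K L \<le> beta_star K * real L"
proof -
  let ?S = "splitting_slots K {..<L}"
  have le: "expected_slots_ennreal K L \<le> ennreal (slots_majorant K L)"
    using splitting_slots_nn_integral_le[OF assms(1), of "{..<L}"]
    by (simp add: expected_slots_ennreal_eq[OF assms(1)])
  then have "expected_slots K L \<le> slots_majorant K L"
    unfolding expected_slots_def by (rule enn2real_leI[OF slots_majorant_nonneg[OF assms(1)]])
  \<comment> \<open>Dropping the summand \<open>- 1\<close> of the majorant leaves a bound
    proportional to \<open>L\<close>.\<close>
  then show "expected_slots K L \<le> beta_star K * real L"
    using assms by (simp add: slots_majorant_def)
  have "{..<L} \<noteq> {}" "\<not> card {..<L} \<le> K" using assms by auto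
  then have "0 \<notin> set_spmf ?S"
    by (subst splitting_slots.simps) (simp only: if_False, auto simp: set_bind_spmf simp del: bind_spmf_of_pmf)
  have "expected_slots_ennreal K L \<noteq> 0"
  proof
    assume "expected_slots_ennreal K L = 0"
    then have "AE n in measure_spmf ?S. (of_nat n :: ennreal) = 0"
      unfolding expected_slots_ennreal_eq[OF assms(1)]
      by (subst (asm) nn_integral_0_iff_AE) auto
    then have "set_spmf ?S \<subseteq> {0}" by (auto simp: AE_measure_spmf_iff)
    with \<open>0 \<notin> set_spmf ?S\<close> have "set_spmf ?S = {}" by auto
    then have "weight_spmf ?S = 0" by (simp add: measure_spmf_zero_iff)
    then show False using weight_splitting_slots[OF assms(1), of "{..<L}"] by simp
  qed
  \<comment> \<open>Finiteness matters since \<open>enn2real\<close> sends \<open>\<top>\<close> to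
    \<open>0\<close>.\<close>
  moreover have "expected_slots_ennreal K L < \<top>"
    using le by (rule order.strict_trans1) simp
  ultimately show "0 < expected_slots K L"
    unfolding expected_slots_def by (simp add: enn2real_positive_iff zero_less_iff_neq_zero)
qed

section \<open>Averaging over the binomial number of users\<close>

theorem theorem4:
  fixes M K :: nat and p :: real
  assumes "prime M" and "1 \<le> K" and "K < M" and "0 < p" and "p < 1"
  shows "mean_resolution_rate K M p \<ge>
    (beta_star K * reg_incomplete_beta (1 - p) (real M - real K) (real K + 1)
       + reg_incomplete_beta p (real K + 1) (real M - real K)
       - contending_prob M p 0 * beta_star K)
    / ((1 - contending_prob M p 0) * beta_star K)"
proof -
  let ?q = "contending_prob M p" and ?S = "expected_slots K"
  define b where "b = beta_star K"
  have b: "b \<ge> 1" unfolding b_def by (rule beta_star_ge_1[OF assms(2)])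
  have q0: "?q 0 < 1"
    using assms by (simp add: contending_prob_def power_less_one_iff)
  have q: "?q L \<ge> 0" for L by (simp add: contending_prob_def)
  have small: "real L / ?S L * ?q L = ?q L" if "L \<in> {1..K}" for L
    using that by (simp add: expected_slots_small)
  have large: "?q L / b \<le> real L / ?S L * ?q L" if "L \<in> {Suc K..M}" for L
  proof -
    have "0 < ?S L" "?S L \<le> b * real L"
      using that expected_slots_large[OF assms(2), of L] by (auto simp: b_def)
    then have "1 / b \<le> real L / ?S L"
      using b by (simp add: field_simps)
    from mult_right_mono[OF this q[of L]] show ?thesis by simp
  qed
  have "{..K} = insert 0 {1..K}" by auto
  then have I1: "reg_incomplete_beta (1 - p) (real M - real K) (real K + 1) = ?q 0 + sum ?q {1..K}"
    using reg_incomplete_beta_eq_binomial_cdf[OF assms(3), of p] assms by simp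
  have I2: "reg_incomplete_beta p (real K + 1) (real M - real K) = sum ?q {Suc K..M}"
    using reg_incomplete_beta_eq_binomial_tail[OF assms(3), of p] assms by simp
  \<comment> \<open>The subtracted \<open>?q 0 * beta_star K\<close> cancels the term for
    \<open>0\<close> users in the first beta value.\<close>
  have "(beta_star K * reg_incomplete_beta (1 - p) (real M - real K) (real K + 1)
       + reg_incomplete_beta p (real K + 1) (real M - real K) - ?q 0 * beta_star K)
      / ((1 - ?q 0) * beta_star K) =
      (sum ?q {1..K} + (\<Sum>L = Suc K..M. ?q L / b)) / (1 - ?q 0)"
    unfolding I1 I2 b_def[symmetric] using b q0
    by (simp add: sum_divide_distrib[symmetric] field_simps)
  also have "\<dots> \<le> (sum ?q {1..K} + (\<Sum>L = Suc K..M. real L / ?S L * ?q L)) / (1 - ?q 0)"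
    using q0 large by (intro divide_right_mono add_left_mono sum_mono) auto
  also have "sum ?q {1..K} = (\<Sum>L = 1..K. real L / ?S L * ?q L)"
    using small by (intro sum.cong) auto
  also have "(\<Sum>L = 1..K. real L / ?S L * ?q L) + (\<Sum>L = Suc K..M. real L / ?S L * ?q L) =
      (\<Sum>L = 1..M. real L / ?S L * ?q L)"
  proof -
    have "{1..M} = {1..K} \<union> {Suc K..M}" using assms by auto
    then show ?thesis by (simp add: sum.union_disjoint)
  qed
  also have "\<dots> / (1 - ?q 0) = mean_resolution_rate K M p"
    by (simp add: mean_resolution_rate_def contending_prob_pos_def sum_divide_distrib)
  finally show ?thesis .
qed

end
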